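(* Suppose that for every follower $i\in\{1,\dots,n\}$ the maps $y_i\mapsto\theta_i(x,y_i,y_{-i})$ and $y_i\mapsto g_{i,j}(x,y_i)$ ($j=1,\dots,p_i$) are convex, with Slater's constraint qualification satisfied at $x=\bar x$. Let $(\bar x,\bar y,\bar\mu)$ be a local minimum of the MPCC reformulation (MPCC) for all vertex points $\bar\mu$ of $\Lambda(\bar x,\bar y)$, and suppose that the problem of follower $i$ satisfies the constant rank constraint qualification (CRCQ) at $(\bar x,\bar y_i)$ for every $i\in\{1,\dots,n\}$. Then $(\bar x,\bar y)$ is a local minimum of the single-leader multi-follower game (SLMFG).
   Context: Setting. There is one leader with decision variable $x\in\mathbb{R}^{n_0}$, restricted to a set $X\subset\mathbb{R}^{n_0}$, and with objective $\theta_0:\mathbb{R}^{n_0}\times\prod_{i=1}^n\mathbb{R}^{n_i}\to\mathbb{R}$. There are $n$ followers; follower $i$ has decision variable $y_i\in\mathbb{R}^{n_i}$. Write $y=(y_1,\dots,y_n)=(y_i,y_{-i})$, where $y_{-i}$ collects the decisions of the followers other than $i$. Follower $i$ has objective $\theta_i(x,y_i,y_{-i})\in\mathbb{R}$ and constraint functions $g_{i,j}:\mathbb{R}^{n_0}\times\mathbb{R}^{n_i}\to\mathbb{R}$, $j=1,\dots,p_i$, with feasible set $Y_i(x)=\{y_i : g_{i,j}(x,y_i)\le 0\ \forall j\}$. Write $g_i=(g_{i,1},\dots,g_{i,p_i})$. Standing smoothness assumptions: the maps $y_i\mapsto\theta_i(x,y_i,y_{-i})$ and $y_i\mapsto g_{i,j}(x,y_i)$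 are continuously differentiable, and the gradients $\nabla_{y_i}\theta_i(x,y_i,y_{-i})$ and $\nabla_{y_i}g_{i,j}(x,y_i)$ are continuous in all of their variables. Nash equilibria. $\mathrm{NEP}(x)$ is the set of $y$ such that, for every $i$, $y_i$ minimizes $\theta_i(x,\cdot,y_{-i})$ over $Y_i(x)$. (SLMFG): minimize $\theta_0(x,y)$ over $(x,y)$ subject to $x\in X$ and $y\in\mathrm{NEP}(x)$. Multiplier sets. $\Lambda_i(x,y)$ is the set of $\mu_i=(\mu_{i,1},\dots,\mu_{i,p_i})\in\mathbb{R}^{p_i}$ such that $$\nabla_{y_i}\theta_i(x,y_i,y_{-i})+\sum_{j=1}^{p_i}\mu_{i,j}\nabla_{y_i}g_{i,j}(x,y_i)=0,\quad g_i(x,y_i)\le 0,\quad \mu_i\ge 0,\quad \langle\mu_i,g_i(x,y_i)\rangle=0,$$ and $\Lambda(x,y)=\prod_{i=1}^n\Lambda_i(x,y)$, a convex polyhedron; its vertices are its extreme points. (MPCC): minimize $\theta_0(x,y)$ over $(x,y,\mu)$, $\mu=(\mu_1,\dots,\mu_n)\in\prod_i\mathbb{R}^{p_i}$, subject to $x\in X$ and $\mu\in\Lambda(x,y)$. Slater's constraint qualification for follower $i$ at $x$: there is $y_i\in\mathbb{R}^{n_i}$ with $g_{i,j}(x,y_i)<0$ for all $j=1,\dots,p_i$. CRCQ for follower $i$ at $(\bar x,\bar y_i)$: there is a neighborhood $V_i$ of $(\bar x,\bar y_i)$ such that for each subset $I$ of the active index set $\{j : g_{i,j}(\bar x,\bar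 y_i)=0\}$ the rank of the matrix $(\nabla_{y_i}g_{i,j}(x,y_i))_{j\in I}$ is constant for $(x,y_i)\in V_i$. A local minimum (local solution) of a problem is a feasible point that minimizes the objective among all feasible points in some neighborhood of it; in (MPCC) the neighborhood is taken in the space of triples $(x,y,\mu)$.
   Formalization: The constraint functions g_{i,j} are additionally assumed jointly continuous in (x,y_i), without which the claim fails (g may jump in x), and Λ(x̄,ȳ) is assumed nonempty, so that the hypothesis on its vertices is not vacuous. *)

theory Defs
  imports "HOL-Analysis.Analysis"
begin

text \<open>
  The follower dimensions $n_i$ and the constraint numbers $p_i$ vary with the follower. The space
  $\mathbb{R}^{n_i}$ is the coordinate subspace of \<^typ>\<open>real ^ 'm\<close> spanned by a set \<open>D i\<close> of
  $n_i$ coordinates, and $\mathbb{R}^{p_i}$ the one of \<^typ>\<open>real ^ 'q\<close> given by the set \<open>C i\<close> of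
  constraint indices of follower \<open>i\<close>. Since \<^typ>\<open>'m\<close> and \<^typ>\<open>'q\<close> are arbitrary finite
  types, all families of dimensions occur (zero included). Values of the objectives and
  constraints outside these subspaces are irrelevant.
\<close>

definition coord_space :: "'k set \<Rightarrow> (real ^ 'k::finite) set" where
  "coord_space K = {v. \<forall>k. k \<notin> K \<longrightarrow> v $ k = 0}"

definition profiles :: "('f \<Rightarrow> 'm set) \<Rightarrow> (real ^ 'm::finite ^ 'f::finite) set" where
  "profiles D = {y. \<forall>i. y $ i \<in> coord_space (D i)}"

definition replace_block :: "'a ^ 'f::finite \<Rightarrow> 'f \<Rightarrow> 'a \<Rightarrow> 'a ^ 'f" where
  "replace_block y i v = (\<chi> j. if j = i then v else y $ j)"

text \<open>
  The gradient of a function on a linear subspace \<open>S\<close>, taken in \<open>S\<close>. It is uniquely determined as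
  soon as the function is differentiable within \<open>S\<close>.
\<close>

definition grad_on :: "'a::euclidean_space set \<Rightarrow> ('a \<Rightarrow> real) \<Rightarrow> 'a \<Rightarrow> 'a" where
  "grad_on S f z = (THE d. d \<in> S \<and> (f has_derivative (\<lambda>h. h \<bullet> d)) (at z within S))"

definition grad_obj ::
  "('f \<Rightarrow> 'm set) \<Rightarrow> ('f \<Rightarrow> 'x \<Rightarrow> real ^ 'm::finite ^ 'f::finite \<Rightarrow> real)
    \<Rightarrow> 'f \<Rightarrow> 'x \<Rightarrow> real ^ 'm ^ 'f \<Rightarrow> real ^ 'm" where
  "grad_obj D \<theta> i x y = grad_on (coord_space (D i)) (\<lambda>v. \<theta> i x (replace_block y i v)) (y $ i)"

definition grad_con ::
  "('f \<Rightarrow> 'm set) \<Rightarrow> ('f \<Rightarrow> 'q \<Rightarrow> 'x \<Rightarrow> real ^ 'm::finite \<Rightarrow> real)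
    \<Rightarrow> 'f \<Rightarrow> 'q \<Rightarrow> 'x \<Rightarrow> real ^ 'm \<Rightarrow> real ^ 'm" where
  "grad_con D g i j x v = grad_on (coord_space (D i)) (g i j x) v"

definition feasible_set ::
  "('f \<Rightarrow> 'm set) \<Rightarrow> ('f \<Rightarrow> 'q set) \<Rightarrow> ('f \<Rightarrow> 'q \<Rightarrow> 'x \<Rightarrow> real ^ 'm::finite \<Rightarrow> real)
    \<Rightarrow> 'f \<Rightarrow> 'x \<Rightarrow> (real ^ 'm) set" where
  "feasible_set D C g i x = {v \<in> coord_space (D i). \<forall>j\<in>C i. g i j x v \<le> 0}"

definition NEP ::
  "('f \<Rightarrow> 'm set) \<Rightarrow> ('f \<Rightarrow> 'q set) \<Rightarrow> ('f \<Rightarrow> 'x \<Rightarrow> real ^ 'm::finite ^ 'f::finite \<Rightarrow> real)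
    \<Rightarrow> ('f \<Rightarrow> 'q \<Rightarrow> 'x \<Rightarrow> real ^ 'm \<Rightarrow> real) \<Rightarrow> 'x \<Rightarrow> (real ^ 'm ^ 'f) set" where
  "NEP D C \<theta> g x = {y \<in> profiles D. \<forall>i. y $ i \<in> feasible_set D C g i x \<and>
     (\<forall>v\<in>feasible_set D C g i x. \<theta> i x y \<le> \<theta> i x (replace_block y i v))}"

definition multipliers_of ::
  "('f \<Rightarrow> 'm set) \<Rightarrow> ('f \<Rightarrow> 'q set) \<Rightarrow> ('f \<Rightarrow> 'x \<Rightarrow> real ^ 'm::finite ^ 'f::finite \<Rightarrow> real)
    \<Rightarrow> ('f \<Rightarrow> 'q \<Rightarrow> 'x \<Rightarrow> real ^ 'm \<Rightarrow> real)
    \<Rightarrow> 'f \<Rightarrow> 'x \<Rightarrow> real ^ 'm ^ 'f \<Rightarrow> (real ^ 'q::finite) set" where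
  "multipliers_of D C \<theta> g i x y = {m \<in> coord_space (C i).
     grad_obj D \<theta> i x y + (\<Sum>j\<in>C i. (m $ j) *\<^sub>R grad_con D g i j x (y $ i)) = 0 \<and>
     (\<forall>j\<in>C i. g i j x (y $ i) \<le> 0) \<and>
     (\<forall>j\<in>C i. 0 \<le> m $ j) \<and>
     (\<Sum>j\<in>C i. m $ j * g i j x (y $ i)) = 0}"

definition multipliers ::
  "('f \<Rightarrow> 'm set) \<Rightarrow> ('f \<Rightarrow> 'q set) \<Rightarrow> ('f \<Rightarrow> 'x \<Rightarrow> real ^ 'm::finite ^ 'f::finite \<Rightarrow> real)
    \<Rightarrow> ('f \<Rightarrow> 'q \<Rightarrow> 'x \<Rightarrow> real ^ 'm \<Rightarrow> real)
    \<Rightarrow> 'x \<Rightarrow> real ^ 'm ^ 'f \<Rightarrow> (real ^ 'q::finite ^ 'f) set" where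
  "multipliers D C \<theta> g x y = {\<mu>. \<forall>i. \<mu> $ i \<in> multipliers_of D C \<theta> g i x y}"

definition local_minimum :: "('a::topological_space \<Rightarrow> real) \<Rightarrow> 'a set \<Rightarrow> 'a \<Rightarrow> bool" where
  "local_minimum f S z \<longleftrightarrow> z \<in> S \<and> (\<exists>U. open U \<and> z \<in> U \<and> (\<forall>w\<in>S \<inter> U. f z \<le> f w))"

definition SLMFG_local_minimum ::
  "('f \<Rightarrow> 'm set) \<Rightarrow> ('f \<Rightarrow> 'q set) \<Rightarrow> 'x::topological_space set
    \<Rightarrow> ('x \<Rightarrow> real ^ 'm::finite ^ 'f::finite \<Rightarrow> real) \<Rightarrow> ('f \<Rightarrow> 'x \<Rightarrow> real ^ 'm ^ 'f \<Rightarrow> real)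
    \<Rightarrow> ('f \<Rightarrow> 'q \<Rightarrow> 'x \<Rightarrow> real ^ 'm \<Rightarrow> real) \<Rightarrow> 'x \<times> (real ^ 'm ^ 'f) \<Rightarrow> bool" where
  "SLMFG_local_minimum D C X \<theta>\<^sub>0 \<theta> g =
     local_minimum (\<lambda>(x, y). \<theta>\<^sub>0 x y) {(x, y). x \<in> X \<and> y \<in> NEP D C \<theta> g x}"

definition MPCC_local_minimum ::
  "('f \<Rightarrow> 'm set) \<Rightarrow> ('f \<Rightarrow> 'q set) \<Rightarrow> 'x::topological_space set
    \<Rightarrow> ('x \<Rightarrow> real ^ 'm::finite ^ 'f::finite \<Rightarrow> real) \<Rightarrow> ('f \<Rightarrow> 'x \<Rightarrow> real ^ 'm ^ 'f \<Rightarrow> real)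
    \<Rightarrow> ('f \<Rightarrow> 'q \<Rightarrow> 'x \<Rightarrow> real ^ 'm \<Rightarrow> real)
    \<Rightarrow> 'x \<times> (real ^ 'm ^ 'f) \<times> (real ^ 'q::finite ^ 'f) \<Rightarrow> bool" where
  "MPCC_local_minimum D C X \<theta>\<^sub>0 \<theta> g =
     local_minimum (\<lambda>(x, y, \<mu>). \<theta>\<^sub>0 x y)
       {(x, y, \<mu>). x \<in> X \<and> y \<in> profiles D \<and> \<mu> \<in> multipliers D C \<theta> g x y}"

definition slater ::
  "('f \<Rightarrow> 'm set) \<Rightarrow> ('f \<Rightarrow> 'q set) \<Rightarrow> ('f \<Rightarrow> 'q \<Rightarrow> 'x \<Rightarrow> real ^ 'm::finite \<Rightarrow> real)
    \<Rightarrow> 'f \<Rightarrow> 'x \<Rightarrow> bool" where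
  "slater D C g i x \<longleftrightarrow> (\<exists>v\<in>coord_space (D i). \<forall>j\<in>C i. g i j x v < 0)"

text \<open>
  The matrix with rows \<open>j \<in> I\<close> is padded with zero rows and columns, which does not change its rank.
\<close>

definition CRCQ ::
  "('f \<Rightarrow> 'm set) \<Rightarrow> ('f \<Rightarrow> 'q::finite set)
    \<Rightarrow> ('f \<Rightarrow> 'q \<Rightarrow> 'x::topological_space \<Rightarrow> real ^ 'm::finite \<Rightarrow> real)
    \<Rightarrow> 'f \<Rightarrow> 'x \<Rightarrow> real ^ 'm \<Rightarrow> bool" where
  "CRCQ D C g i x\<^sub>0 v\<^sub>0 \<longleftrightarrow> (\<exists>V. open V \<and> (x\<^sub>0, v\<^sub>0) \<in> V \<and>
     (\<forall>I \<subseteq> {j \<in> C i. g i j x\<^sub>0 v\<^sub>0 = 0}. \<exists>r. \<forall>x v. (x, v) \<in> V \<and> v \<in> coord_space (D i) \<longrightarrow>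
        rank ((\<chi> j. if j \<in> I then grad_con D g i j x v else 0) :: real ^ 'm ^ 'q) = r))"

end

theory Submission
  imports Defs
begin

text \<open>
  If \<open>(x\<^sub>0, y\<^sub>0)\<close> were not a local solution of the game, there would be better equilibria
  \<open>(x\<^sub>k, y\<^sub>k)\<close> converging to it. Local optimality in the MPCC is known only for triples whose
  multiplier is a vertex of \<open>\<Lambda>(x\<^sub>0, y\<^sub>0)\<close>, so what has to be shown is that the nearby equilibria
  carry multipliers \<open>\<mu>\<^sub>k\<close> which, along a subsequence, converge to such a vertex \<open>\<mu>\<close>. Then
  \<open>(x\<^sub>k, y\<^sub>k, \<mu>\<^sub>k)\<close> is feasible for the MPCC, comes close to \<open>(x\<^sub>0, y\<^sub>0, \<mu>)\<close> and has a smaller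
  objective value, which contradicts local optimality at \<open>\<mu>\<close>.

  Slater's condition does two things. It persists for parameters near \<open>x\<^sub>0\<close>, so that each
  equilibrium \<open>(x\<^sub>k, y\<^sub>k)\<close> has KKT multipliers at all, and it bounds them uniformly: testing
  stationarity in the direction of a Slater point \<open>w\<close> gives
  \<open>c \<cdot> \<Sum>\<^sub>j \<mu>\<^sub>j \<le> \<langle>\<nabla>\<theta>\<^sub>i, w - y\<^sub>i\<rangle>\<close> when all constraints are at most \<open>-c\<close> at \<open>w\<close>
  (\<open>slater_locally_bounds_multipliers\<close>). Hence the multiplier sets are compact, they have
  vertices, and vertices \<open>\<mu>\<^sub>k\<close> can be chosen that converge along a subsequence.

  The constant rank condition makes the limit a vertex again. A multiplier is a vertex exactly when
  the constraint gradients on its support are linearly independent (\<open>extreme_multiplier_iff\<close>).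
  Each constraint in the support of the limit \<open>\<mu>\<close> is in the support of \<open>\<mu>\<^sub>k\<close> for large \<open>k\<close>,
  so the gradients of these constraints are independent at \<open>(x\<^sub>k, y\<^sub>k)\<close>. Since the constraints
  are active at the limit, their gradients have locally constant rank there, and they are
  independent at \<open>(x\<^sub>0, y\<^sub>0)\<close> as well (\<open>limit_of_extreme_multipliers\<close>).

  Convexity gives the passage between equilibria and multipliers: stationarity implies optimality
  by the gradient inequality, and the converse follows from Gordan's theorem of the alternative
  and Slater's condition.
\<close>

section \<open>Gradients on a subspace\<close>

lemma subspace_representer:
  fixes L :: "'a::euclidean_space \<Rightarrow> real"
  assumes S: "subspace S" and L: "linear L"
  obtains d where "d \<in> S" "\<And>h. h \<in> S \<Longrightarrow> L h = h \<bullet> d"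
proof -
  define a where "a = (\<Sum>b\<in>Basis. L b *\<^sub>R b)"
  have a: "L h = h \<bullet> a" for h
  proof -
    have "L h = L (\<Sum>b\<in>Basis. (h \<bullet> b) *\<^sub>R b)" by (simp add: euclidean_representation)
    also have "\<dots> = h \<bullet> a"
      by (simp add: a_def linear_sum[OF L] linear_scale[OF L] inner_sum_right mult.commute)
    finally show ?thesis .
  qed
  obtain d e where d: "d \<in> span S" and e: "\<And>w. w \<in> span S \<Longrightarrow> orthogonal e w" and "a = d + e"
    using orthogonal_subspace_decomp_exists[of S a] by blast
  have "L h = h \<bullet> d" if "h \<in> S" for h
    using e[of h] that \<open>a = d + e\<close> by (simp add: a inner_add_right orthogonal_def inner_commute span_base)
  moreover have "d \<in> S" using d S by (metis span_eq_iff)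
  ultimately show ?thesis using that by blast
qed

lemma has_derivative_along_line:
  fixes f :: "'a::euclidean_space \<Rightarrow> real"
  assumes S: "subspace S" and "z \<in> S" "h \<in> S"
    and f: "(f has_derivative (\<lambda>h. h \<bullet> d)) (at z within S)"
  shows "((\<lambda>t. f (z + t *\<^sub>R h)) has_real_derivative (h \<bullet> d)) (at 0)"
proof -
  have sub: "range (\<lambda>t. z + t *\<^sub>R h) \<subseteq> S"
    using assms by (auto intro: subspace_add subspace_scale)
  have "((\<lambda>t. z + t *\<^sub>R h) has_derivative (\<lambda>t. t *\<^sub>R h)) (at 0)"
    by (auto intro!: derivative_eq_intros)
  moreover have "(f has_derivative (\<lambda>h. h \<bullet> d)) (at (z + 0 *\<^sub>R h) within range (\<lambda>t. z + t *\<^sub>R h))"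
    using has_derivative_subset[OF f sub] by simp
  ultimately have "((\<lambda>t. f (z + t *\<^sub>R h)) has_derivative (\<lambda>t. (t *\<^sub>R h) \<bullet> d)) (at 0)"
    by (rule has_derivative_in_compose)
  then show ?thesis
    unfolding has_field_derivative_def by (rule has_derivative_eq_rhs) (simp add: fun_eq_iff)
qed

text \<open>
  Only the values of a derivative on \<open>S\<close> matter for differentiability within \<open>S\<close>, so it may be
  replaced by its representing vector in \<open>S\<close>. Differentiating along lines inside \<open>S\<close> shows that
  this vector is unique, which turns the definite description in \<open>grad_on\<close> into a usable gradient.
\<close>
lemma grad_on:
  fixes f :: "'a::euclidean_space \<Rightarrow> real"
  assumes S: "subspace S" and z: "z \<in> S" and f: "f differentiable_on S"
  shows grad_on_in: "grad_on S f z \<in> S"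
    and has_derivative_grad_on: "(f has_derivative (\<lambda>h. h \<bullet> grad_on S f z)) (at z within S)"
proof -
  obtain L where L: "(f has_derivative L) (at z within S)"
    using f z unfolding differentiable_on_def differentiable_def by blast
  obtain d where d: "d \<in> S" "\<And>h. h \<in> S \<Longrightarrow> L h = h \<bullet> d"
    using subspace_representer[OF S has_derivative_linear[OF L]] by blast
  have der: "(f has_derivative (\<lambda>h. h \<bullet> d)) (at z within S)"
  proof -
    have "((\<lambda>y. (1 / norm (y - z)) *\<^sub>R (f y - (f z + L (y - z)))) \<longlongrightarrow> 0) (at z within S)"
      using L by (simp add: has_derivative_within)
    moreover have "\<forall>\<^sub>F y in at z within S. (1 / norm (y - z)) *\<^sub>R (f y - (f z + L (y - z)))
        = (1 / norm (y - z)) *\<^sub>R (f y - (f z + (y - z) \<bullet> d))"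
      using d(2) S z by (auto simp: eventually_at_filter subspace_diff intro!: always_eventually)
    ultimately have "((\<lambda>y. (1 / norm (y - z)) *\<^sub>R (f y - (f z + (y - z) \<bullet> d))) \<longlongrightarrow> 0) (at z within S)"
      by (rule Lim_transform_eventually)
    then show ?thesis by (simp add: has_derivative_within bounded_linear_inner_left)
  qed
  have "\<exists>!d. d \<in> S \<and> (f has_derivative (\<lambda>h. h \<bullet> d)) (at z within S)"
  proof (rule ex1I[of _ d])
    fix e assume "e \<in> S \<and> (f has_derivative (\<lambda>h. h \<bullet> e)) (at z within S)"
    then have e: "e \<in> S" "(f has_derivative (\<lambda>h. h \<bullet> e)) (at z within S)" by auto
    have h: "e - d \<in> S" using S e(1) d(1) by (rule subspace_diff)
    have "(e - d) \<bullet> e = (e - d) \<bullet> d"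
      by (rule DERIV_unique[OF has_derivative_along_line[OF S z h e(2)] has_derivative_along_line[OF S z h der]])
    then have "(e - d) \<bullet> (e - d) = 0" by (simp add: inner_diff_right)
    then show "e = d" by simp
  qed (use d der in blast)
  from theI'[OF this, folded grad_on_def] show "grad_on S f z \<in> S"
    "(f has_derivative (\<lambda>h. h \<bullet> grad_on S f z)) (at z within S)"
    by simp_all
qed

text \<open>
  The one-dimensional tangent inequality on the line through \<open>z\<close> and \<open>v\<close>.
\<close>
lemma convex_on_above_tangent_grad_on:
  fixes f :: "'a::euclidean_space \<Rightarrow> real"
  assumes S: "subspace S" and z: "z \<in> S" and v: "v \<in> S"
    and f: "f differentiable_on S" and conv: "convex_on S f"
  shows "f z + (v - z) \<bullet> grad_on S f z \<le> f v"
proof -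
  have h: "v - z \<in> S" using S z v by (blast intro: subspace_diff)
  have line: "z + t *\<^sub>R (v - z) \<in> S" for t
    using S z h by (blast intro: subspace_add subspace_scale)
  have "convex_on UNIV (\<lambda>t. f (z + t *\<^sub>R (v - z)))"
  proof (rule convex_onI)
    fix t a b :: real assume "0 < t" "t < 1"
    then have "f ((1 - t) *\<^sub>R (z + a *\<^sub>R (v - z)) + t *\<^sub>R (z + b *\<^sub>R (v - z)))
        \<le> (1 - t) * f (z + a *\<^sub>R (v - z)) + t * f (z + b *\<^sub>R (v - z))"
      by (intro convex_onD[OF conv]) (auto simp: line)
    moreover have "(1 - t) *\<^sub>R (z + a *\<^sub>R (v - z)) + t *\<^sub>R (z + b *\<^sub>R (v - z))
        = z + ((1 - t) *\<^sub>R a + t *\<^sub>R b) *\<^sub>R (v - z)"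
      by (simp add: algebra_simps)
    ultimately show "f (z + ((1 - t) *\<^sub>R a + t *\<^sub>R b) *\<^sub>R (v - z))
        \<le> (1 - t) * f (z + a *\<^sub>R (v - z)) + t * f (z + b *\<^sub>R (v - z))"
      by simp
  qed simp
  then have "((v - z) \<bullet> grad_on S f z) * (1 - 0) \<le> f (z + 1 *\<^sub>R (v - z)) - f (z + 0 *\<^sub>R (v - z))"
    by (rule convex_on_imp_above_tangent)
      (auto intro: has_derivative_along_line[OF S z h has_derivative_grad_on[OF S z f]])
  then show ?thesis by simp
qed

lemma descends_along_line:
  fixes f :: "'a::euclidean_space \<Rightarrow> real"
  assumes S: "subspace S" and z: "z \<in> S" and h: "h \<in> S"
    and f: "f differentiable_on S" and neg: "h \<bullet> grad_on S f z < 0"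
  shows "\<forall>\<^sub>F t in at_right 0. f (z + t *\<^sub>R h) < f z"
proof -
  have "((\<lambda>t. f (z + t *\<^sub>R h)) has_real_derivative (h \<bullet> grad_on S f z)) (at 0)"
    by (rule has_derivative_along_line[OF S z h has_derivative_grad_on[OF S z f]])
  from DERIV_neg_dec_right[OF this neg] show ?thesis
    by (auto simp: eventually_at_right_field)
qed

lemma negative_along_line:
  fixes f :: "'a::euclidean_space \<Rightarrow> real"
  assumes S: "subspace S" and z: "z \<in> S" and h: "h \<in> S"
    and f: "f differentiable_on S" and neg: "f z < 0"
  shows "\<forall>\<^sub>F t in at_right 0. f (z + t *\<^sub>R h) < 0"
proof -
  have "isCont (\<lambda>t. f (z + t *\<^sub>R h)) 0"
    by (rule DERIV_isCont[OF has_derivative_along_line[OF S z h has_derivative_grad_on[OF S z f]]])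
  then have "((\<lambda>t. f (z + t *\<^sub>R h)) \<longlongrightarrow> f z) (at_right 0)"
    by (auto simp: isCont_def intro: tendsto_mono[OF at_le])
  then show ?thesis using neg by (rule order_tendstoD(2))
qed

section \<open>Karush--Kuhn--Tucker multipliers of a convex problem\<close>

text \<open>
  Gordan's theorem of the alternative, relative to a subspace. Either the convex hull of the vectors
  contains the origin, or its point nearest to the origin has positive inner product with every
  element of the hull, and the negative of that point is a common descent direction. It lies in
  \<open>S\<close> because the hull does.
\<close>
lemma gordan_alternative [consumes 3]:
  fixes a :: "'j \<Rightarrow> 'a::euclidean_space"
  assumes "finite J" "subspace S" "a ` J \<subseteq> S"
  obtains (descent) h where "h \<in> S" "\<And>j. j \<in> J \<Longrightarrow> h \<bullet> a j < 0"
  | (combination) u where "\<And>j. j \<in> J \<Longrightarrow> 0 \<le> u j" "sum u J = (1::real)" "(\<Sum>j\<in>J. u j *\<^sub>R a j) = 0"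
proof -
  let ?K = "convex hull (a ` J)"
  have K: "closed ?K" "?K \<subseteq> S"
    by (rule compact_imp_closed[OF finite_imp_compact_convex_hull[OF finite_imageI[OF assms(1)]]])
      (rule hull_minimal[where S = convex, OF assms(3) subspace_imp_convex[OF assms(2)]])
  show ?thesis
  proof (cases "J = {} \<or> 0 \<notin> ?K")
    case True
    show ?thesis
    proof (cases "J = {}")
      case False
      then obtain p where p: "p \<in> ?K" "\<And>q. q \<in> ?K \<Longrightarrow> dist 0 p \<le> dist 0 q"
        using distance_attains_inf[OF K(1), of 0] by auto
      have "- p \<in> S" using p K assms(2) by (auto intro: subspace_neg)
      moreover have "(- p) \<bullet> a j < 0" if "j \<in> J" for j
      proof -
        have "a j \<in> ?K" using that by (simp add: hull_inc)
        then have "(0 - p) \<bullet> (a j - p) \<le> 0"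
          by (intro any_closest_point_dot[of ?K]) (use K p in auto)
        moreover have "p \<bullet> p > 0" using p True False by auto
        ultimately show ?thesis by (simp add: inner_diff_right del: inner_gt_zero_iff)
      qed
      ultimately show ?thesis by (rule descent)
    qed (use descent[of 0] subspace_0[OF assms(2)] in auto)
  next
    case False
    \<comment> \<open>The weights are indexed by \<open>J\<close> and not by the vectors, which may coincide for different indices.\<close>
    let ?W = "{\<Sum>j\<in>J. u j *\<^sub>R a j | u. (\<forall>j\<in>J. 0 \<le> u j) \<and> sum u J = (1::real)}"
    have "a ` J \<subseteq> ?W"
    proof clarify
      fix j assume "j \<in> J"
      then show "\<exists>u. a j = (\<Sum>k\<in>J. u k *\<^sub>R a k) \<and> (\<forall>k\<in>J. 0 \<le> u k) \<and> sum u J = (1::real)"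
        using assms(1) by (intro exI[of _ "\<lambda>k. if k = j then 1 else 0"])
          (auto simp: if_distrib[of "\<lambda>c. c *\<^sub>R _"] cong: if_cong)
    qed
    moreover have "convex ?W"
    proof (rule convexI, clarify)
      fix s t :: real and u w :: "'j \<Rightarrow> real"
      assume "0 \<le> s" "0 \<le> t" "s + t = 1" "\<forall>j\<in>J. 0 \<le> u j" "sum u J = 1" "\<forall>j\<in>J. 0 \<le> w j" "sum w J = 1"
      then show "\<exists>v. s *\<^sub>R (\<Sum>j\<in>J. u j *\<^sub>R a j) + t *\<^sub>R (\<Sum>j\<in>J. w j *\<^sub>R a j) = (\<Sum>j\<in>J. v j *\<^sub>R a j)
          \<and> (\<forall>j\<in>J. 0 \<le> v j) \<and> sum v J = 1"
        by (intro exI[of _ "\<lambda>j. s * u j + t * w j"])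
          (simp add: sum.distrib scaleR_left_distrib scaleR_sum_right flip: sum_distrib_left)
    qed
    ultimately have "?K \<subseteq> ?W" by (rule hull_minimal)
    then have "0 \<in> ?W" using False by blast
    then obtain u where "\<forall>j\<in>J. 0 \<le> u j" "sum u J = (1::real)" "0 = (\<Sum>j\<in>J. u j *\<^sub>R a j)"
      by blast
    then show ?thesis using combination[of u] by auto
  qed
qed

text \<open>
  Gordan's alternative is applied to the gradients of the objective and of the active constraints.
  A common descent direction would lead to better feasible points, so a nontrivial nonnegative
  combination of the gradients vanishes (the Fritz John conditions). The objective has positive
  weight in it: otherwise the weighted constraint gradients would cancel, although each of them has
  negative inner product with the direction towards the Slater point \<open>w\<close>. Dividing by this weight
  gives the multipliers.
\<close>
lemma convex_minimizer_has_kkt_multipliers: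
  fixes f :: "'a::euclidean_space \<Rightarrow> real" and c :: "'j \<Rightarrow> 'a \<Rightarrow> real"
  assumes J: "finite J" and S: "subspace S" and z: "z \<in> S" and f: "f differentiable_on S"
    and c: "\<And>j. j \<in> J \<Longrightarrow> c j differentiable_on S" "\<And>j. j \<in> J \<Longrightarrow> convex_on S (c j)"
    and w: "w \<in> S" "\<And>j. j \<in> J \<Longrightarrow> c j w < 0"
    and feas: "\<And>j. j \<in> J \<Longrightarrow> c j z \<le> 0"
    and min: "\<And>v. v \<in> S \<Longrightarrow> (\<And>j. j \<in> J \<Longrightarrow> c j v \<le> 0) \<Longrightarrow> f z \<le> f v"
  obtains u where "\<And>j. j \<in> J \<Longrightarrow> 0 \<le> u j" "\<And>j. j \<in> J \<Longrightarrow> u j * c j z = 0"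
    "grad_on S f z + (\<Sum>j\<in>J. u j *\<^sub>R grad_on S (c j) z) = 0"
proof -
  define A where "A = {j\<in>J. c j z = 0}"
  have A: "finite A" "A \<subseteq> J" "\<And>j. j \<in> A \<Longrightarrow> c j z = 0" using J by (auto simp: A_def)
  \<comment> \<open>\<open>None\<close> stands for the objective.\<close>
  define a where "a k = (case k of None \<Rightarrow> grad_on S f z | Some j \<Rightarrow> grad_on S (c j) z)" for k
  let ?K = "insert None (Some ` A)"
  have "finite ?K" "a ` ?K \<subseteq> S" using A c f by (auto simp: a_def grad_on_in S z)
  from this(1) S this(2) show ?thesis
  proof (cases rule: gordan_alternative)
    case (descent h)
    have "\<forall>\<^sub>F t in at_right 0. c j (z + t *\<^sub>R h) < 0" if "j \<in> J" for j
    proof (cases "j \<in> A")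
      case True
      then show ?thesis
        using descends_along_line[OF S z \<open>h \<in> S\<close> c(1)[OF that]] descent(2)[of "Some j"] A(3)
        by (simp add: a_def)
    next
      case False
      then have "c j z < 0" using feas that by (force simp: A_def)
      then show ?thesis by (rule negative_along_line[OF S z \<open>h \<in> S\<close> c(1)[OF that]])
    qed
    then have "\<forall>\<^sub>F t in at_right 0. \<forall>j\<in>J. c j (z + t *\<^sub>R h) < 0"
      using J by (simp add: eventually_ball_finite)
    moreover have "\<forall>\<^sub>F t in at_right 0. f (z + t *\<^sub>R h) < f z"
      using descends_along_line[OF S z \<open>h \<in> S\<close> f] descent(2)[of None] by (simp add: a_def)
    ultimately have "\<forall>\<^sub>F t in at_right (0::real). False"
    proof eventually_elim
      case (elim t)
      have "z + t *\<^sub>R h \<in> S" using S z \<open>h \<in> S\<close> by (blast intro: subspace_add subspace_scale)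
      from min[OF this] elim show False by force
    qed
    then show ?thesis by simp
  next
    case (combination u)
    define s where "s j = u (Some j)" for j
    have eq: "u None *\<^sub>R grad_on S f z + (\<Sum>j\<in>A. s j *\<^sub>R grad_on S (c j) z) = 0"
      using combination(3) A(1) by (simp add: a_def s_def sum.reindex)
    have s: "\<And>j. j \<in> A \<Longrightarrow> 0 \<le> s j" and u0: "0 \<le> u None" and one: "u None + sum s A = 1"
      using combination A(1) by (auto simp: s_def sum.reindex)
    have pos: "u None > 0"
    proof (rule ccontr)
      assume "\<not> u None > 0"
      then have zero: "u None = 0" using u0 by simp
      have neg: "(w - z) \<bullet> grad_on S (c j) z < 0" if "j \<in> A" for j
      proof -
        have "j \<in> J" using that A by blast
        from convex_on_above_tangent_grad_on[OF S z w(1) c(1,2)[OF this]] w(2)[OF this] A(3)[OF that]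
        show ?thesis by simp
      qed
      have "(\<Sum>j\<in>A. s j * - ((w - z) \<bullet> grad_on S (c j) z))
          = - ((w - z) \<bullet> (\<Sum>j\<in>A. s j *\<^sub>R grad_on S (c j) z))"
        by (simp add: inner_sum_right sum_negf)
      also have "\<dots> = 0" using eq zero by simp
      finally have "\<forall>j\<in>A. s j * - ((w - z) \<bullet> grad_on S (c j) z) = 0"
        by (subst (asm) sum_nonneg_eq_0_iff[OF A(1)])
          (use s neg in \<open>auto intro!: mult_nonneg_nonpos simp: less_imp_le\<close>)
      then have "sum s A = 0" using neg by (intro sum.neutral) force
      then show False using one zero by simp
    qed
    define m where "m j = (if j \<in> A then s j / u None else 0)" for j
    show ?thesis
    proof (rule that[of m])
      have "(\<Sum>j\<in>J. m j *\<^sub>R grad_on S (c j) z) = (\<Sum>j\<in>A. (s j / u None) *\<^sub>R grad_on S (c j) z)"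
        using J A(2) by (intro sum.mono_neutral_cong_right) (auto simp: m_def)
      also have "\<dots> = (1 / u None) *\<^sub>R (\<Sum>j\<in>A. s j *\<^sub>R grad_on S (c j) z)"
        by (simp add: scaleR_sum_right)
      also have "\<dots> = (1 / u None) *\<^sub>R (- (u None *\<^sub>R grad_on S f z))"
        using eq by (simp add: add_eq_0_iff)
      also have "\<dots> = - grad_on S f z" using pos by simp
      finally show "grad_on S f z + (\<Sum>j\<in>J. m j *\<^sub>R grad_on S (c j) z) = 0" by simp
    qed (use s pos A(3) in \<open>auto simp: m_def\<close>)
  qed
qed

section \<open>Linear independence and rank\<close>

text \<open>
  Independence of a family, not of its range: a repeated vector makes the family dependent. This is
  the notion measured by the rank of a matrix with the rows \<open>a j\<close>.
\<close>
definition independent_family :: "('j \<Rightarrow> 'a::real_vector) \<Rightarrow> 'j set \<Rightarrow> bool" where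
  "independent_family a I \<longleftrightarrow> (\<forall>c. (\<Sum>j\<in>I. c j *\<^sub>R a j) = 0 \<longrightarrow> (\<forall>j\<in>I. c j = 0))"

lemma independent_familyD:
  "independent_family a I \<Longrightarrow> (\<Sum>j\<in>I. c j *\<^sub>R a j) = 0 \<Longrightarrow> j \<in> I \<Longrightarrow> c j = 0"
  by (auto simp: independent_family_def)

lemma independent_family_subset:
  assumes "independent_family a I" "finite I" "J \<subseteq> I"
  shows "independent_family a J"
  unfolding independent_family_def
proof (intro allI impI ballI)
  fix c j assume c: "(\<Sum>j\<in>J. c j *\<^sub>R a j) = 0" and j: "j \<in> J"
  have "(\<Sum>j\<in>I. (if j \<in> J then c j else 0) *\<^sub>R a j) = (\<Sum>j\<in>J. c j *\<^sub>R a j)"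
    using assms by (intro sum.mono_neutral_cong_right) auto
  then show "c j = 0" using independent_familyD[OF assms(1), of "\<lambda>j. if j \<in> J then c j else 0" j] c j assms(3)
    by auto
qed

lemma independent_family_iff_dim:
  fixes a :: "'j \<Rightarrow> 'a::euclidean_space"
  assumes I: "finite I"
  shows "independent_family a I \<longleftrightarrow> dim (a ` I) = card I"
proof
  assume ind: "independent_family a I"
  have inj: "inj_on a I"
  proof (rule inj_onI, rule ccontr)
    fix j k assume jk: "j \<in> I" "k \<in> I" "a j = a k" "j \<noteq> k"
    let ?c = "\<lambda>l. (if l = j then 1 else 0) - (if l = k then 1 else (0::real))"
    have "(\<Sum>l\<in>I. ?c l *\<^sub>R a l) = 0"
      using jk I by (simp add: scaleR_left_diff_distrib sum_subtractf if_distrib[of "\<lambda>c. c *\<^sub>R _"] cong: if_cong)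
    from independent_familyD[OF ind this jk(1)] jk(4) show False by simp
  qed
  have "independent (a ` I)"
  proof (rule independent_if_scalars_zero)
    fix u v assume "(\<Sum>v\<in>a ` I. u v *\<^sub>R v) = 0" "v \<in> a ` I"
    then show "u v = 0"
      using independent_familyD[OF ind, of "\<lambda>j. u (a j)"] inj by (auto simp: sum.reindex)
  qed (use I in simp)
  then show "dim (a ` I) = card I" by (simp add: dim_eq_card_independent card_image[OF inj])
next
  assume dim: "dim (a ` I) = card I"
  have "dim (a ` I) \<le> card (a ` I)" using I by (intro dim_le_card) (auto intro: span_base)
  then have eq: "card (a ` I) = card I" using dim card_image_le[OF I, of a] by linarith
  then have inj: "inj_on a I" using I by (rule eq_card_imp_inj_on[rotated])
  have ind: "independent (a ` I)"
    using I dim eq by (intro card_le_dim_spanning[of _ "a ` I"]) (auto intro: span_base)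
  show "independent_family a I"
    unfolding independent_family_def
  proof (intro allI impI ballI)
    fix c j assume c: "(\<Sum>j\<in>I. c j *\<^sub>R a j) = 0" and j: "j \<in> I"
    have "(\<Sum>v\<in>a ` I. c (the_inv_into I a v) *\<^sub>R v) = (\<Sum>j\<in>I. c j *\<^sub>R a j)"
      using inj by (simp add: sum.reindex the_inv_into_f_f)
    then have "c (the_inv_into I a (a j)) = 0"
      using c j I by (intro independentD[OF ind, of "a ` I"]) auto
    then show "c j = 0" using inj j by (simp add: the_inv_into_f_f)
  qed
qed

lemma independent_family_iff_rank:
  fixes a :: "'q::finite \<Rightarrow> real ^ 'm"
  shows "independent_family a I \<longleftrightarrow> rank ((\<chi> j. if j \<in> I then a j else 0) :: real ^ 'm ^ 'q) = card I"
proof -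
  have "rows ((\<chi> j. if j \<in> I then a j else 0) :: real ^ 'm ^ 'q) = (\<lambda>j. if j \<in> I then a j else 0) ` UNIV"
    by (auto simp: rows_def row_def vec_eq_iff image_iff)
  moreover have "dim ((\<lambda>j. if j \<in> I then a j else 0) ` UNIV) = dim (a ` I)"
  proof (rule span_eq_dim, rule subset_antisym)
    show "span ((\<lambda>j. if j \<in> I then a j else 0) ` UNIV) \<subseteq> span (a ` I)"
      by (rule span_minimal) (auto intro: span_base span_zero)
    show "span (a ` I) \<subseteq> span ((\<lambda>j. if j \<in> I then a j else 0) ` UNIV)"
      by (rule span_mono) (auto simp: image_iff)
  qed
  ultimately show ?thesis by (simp add: independent_family_iff_dim row_rank_def)
qed

section \<open>Vertices of the multiplier sets\<close>

lemma subspace_coord_space: "subspace (coord_space K)"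
  by (auto simp: coord_space_def subspace_def)

text \<open>
  All terms of the vanishing sum are nonpositive.
\<close>
lemma multipliers_of_complementarity:
  assumes "m \<in> multipliers_of D C \<theta> g i x y" "j \<in> C i"
  shows "m $ j * g i j x (y $ i) = 0"
proof -
  have "(\<Sum>j\<in>C i. - (m $ j * g i j x (y $ i))) = 0"
    using assms by (simp add: multipliers_of_def sum_negf)
  then have "\<forall>j\<in>C i. - (m $ j * g i j x (y $ i)) = 0"
    by (subst (asm) sum_nonneg_eq_0_iff) (use assms in \<open>auto simp: multipliers_of_def mult_nonneg_nonpos\<close>)
  then show ?thesis using assms(2) by simp
qed

lemma convex_multipliers_of: "convex (multipliers_of D C \<theta> g i x y)"
proof (rule convexI)
  fix p q and s t :: real
  assume p: "p \<in> multipliers_of D C \<theta> g i x y" and q: "q \<in> multipliers_of D C \<theta> g i x y"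
    and st: "0 \<le> s" "0 \<le> t" "s + t = 1"
  let ?G = "grad_obj D \<theta> i x y" and ?a = "\<lambda>j. grad_con D g i j x (y $ i)"
  have "?G + (\<Sum>j\<in>C i. (s *\<^sub>R p + t *\<^sub>R q) $ j *\<^sub>R ?a j)
      = (s + t) *\<^sub>R ?G + (s *\<^sub>R (\<Sum>j\<in>C i. p $ j *\<^sub>R ?a j) + t *\<^sub>R (\<Sum>j\<in>C i. q $ j *\<^sub>R ?a j))"
    by (simp add: st(3) scaleR_left_distrib sum.distrib scaleR_sum_right)
  also have "\<dots> = s *\<^sub>R (?G + (\<Sum>j\<in>C i. p $ j *\<^sub>R ?a j)) + t *\<^sub>R (?G + (\<Sum>j\<in>C i. q $ j *\<^sub>R ?a j))"
    by (simp add: scaleR_left_distrib scaleR_right_distrib)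
  also have "\<dots> = 0" using p q by (simp add: multipliers_of_def)
  finally have stat: "?G + (\<Sum>j\<in>C i. (s *\<^sub>R p + t *\<^sub>R q) $ j *\<^sub>R ?a j) = 0" .
  have "(\<Sum>j\<in>C i. (s *\<^sub>R p + t *\<^sub>R q) $ j * g i j x (y $ i)) = 0"
  proof (intro sum.neutral ballI)
    fix j assume "j \<in> C i"
    from multipliers_of_complementarity[OF p this] multipliers_of_complementarity[OF q this]
    show "(s *\<^sub>R p + t *\<^sub>R q) $ j * g i j x (y $ i) = 0" by auto
  qed
  then show "s *\<^sub>R p + t *\<^sub>R q \<in> multipliers_of D C \<theta> g i x y"
    using p q st stat by (auto simp: multipliers_of_def coord_space_def)
qed

lemma multipliers_of_perturb:
  assumes m: "m \<in> multipliers_of D C \<theta> g i x y"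
    and e: "\<And>j. j \<notin> C i \<or> m $ j = 0 \<Longrightarrow> e $ j = 0"
    and combination: "(\<Sum>j\<in>C i. e $ j *\<^sub>R grad_con D g i j x (y $ i)) = 0"
    and nonneg: "\<And>j. j \<in> C i \<Longrightarrow> 0 \<le> m $ j + e $ j"
  shows "m + e \<in> multipliers_of D C \<theta> g i x y"
proof -
  have "(\<Sum>j\<in>C i. e $ j * g i j x (y $ i)) = 0"
  proof (intro sum.neutral ballI)
    fix j assume "j \<in> C i"
    from multipliers_of_complementarity[OF m this] e[of j] show "e $ j * g i j x (y $ i) = 0" by auto
  qed
  then show ?thesis
    using m e combination nonneg
    by (auto simp: multipliers_of_def coord_space_def scaleR_left_distrib distrib_right sum.distrib
        simp flip: add.assoc)
qed

text \<open>
  A linear dependence between the gradients on the support of \<open>m\<close> is a direction in which \<open>m\<close> can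
  be moved both ways: small multiples keep the positive entries positive, and the constraints
  involved are active, so complementarity survives. Conversely, the endpoints of a segment with
  \<open>m\<close> in its interior, inside the polyhedron, vanish wherever \<open>m\<close> does, because their entries are
  nonnegative; their
  difference is then a dependence on the support.
\<close>
lemma extreme_multiplier_iff:
  fixes m :: "real ^ 'q::finite"
  shows "m extreme_point_of multipliers_of D C \<theta> g i x y \<longleftrightarrow>
    m \<in> multipliers_of D C \<theta> g i x y \<and>
    independent_family (\<lambda>j. grad_con D g i j x (y $ i)) {j \<in> C i. m $ j \<noteq> 0}"
    (is "_ \<longleftrightarrow> m \<in> ?\<Lambda> \<and> independent_family ?a ?I")
proof safe
  assume ext: "m extreme_point_of ?\<Lambda>"
  then show m: "m \<in> ?\<Lambda>" by (simp add: extreme_point_of_def)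
  show "independent_family ?a ?I"
    unfolding independent_family_def
  proof (intro allI impI, rule ccontr)
    fix c assume c: "(\<Sum>j\<in>?I. c j *\<^sub>R ?a j) = 0" and "\<not> (\<forall>j\<in>?I. c j = 0)"
    then obtain k where k: "k \<in> ?I" "c k \<noteq> 0" by auto
    define e :: "real ^ 'q" where "e = (\<chi> j. if j \<in> ?I then c j else 0)"
    have e0: "e $ j = 0" if "j \<notin> C i \<or> m $ j = 0" for j using that by (auto simp: e_def)
    have esum: "(\<Sum>j\<in>C i. e $ j *\<^sub>R ?a j) = 0"
      unfolding c[symmetric] by (intro sum.mono_neutral_cong_right) (auto simp: e_def)
    have "e $ k \<noteq> 0" using k by (simp add: e_def)
    then have enz: "e \<noteq> 0" by auto
    \<comment> \<open>A step length at which no entry of \<open>m \<plusminus> t e\<close> on the support becomes negative.\<close>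
    define t where "t = Min ((\<lambda>j. m $ j) ` ?I) / norm e"
    have mpos: "0 < m $ j" if "j \<in> ?I" for j
      using m that by (auto simp: multipliers_of_def less_le)
    have "0 < Min ((\<lambda>j. m $ j) ` ?I)" using k mpos by (subst Min_gr_iff) auto
    then have "0 < t" using enz by (simp add: t_def)
    have bound: "\<bar>t * e $ j\<bar> \<le> m $ j" if "j \<in> C i" for j
    proof (cases "j \<in> ?I")
      case True
      have "\<bar>t * e $ j\<bar> \<le> t * norm e"
        using \<open>0 < t\<close> component_le_norm_cart[of e j] by (simp add: abs_mult)
      also have "\<dots> = Min ((\<lambda>j. m $ j) ` ?I)" using enz by (simp add: t_def)
      also have "\<dots> \<le> m $ j" using True by (intro Min_le) auto
      finally show ?thesis .
    next
      case False
      then show ?thesis using that e0[of j] by simp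
    qed
    have in_both: "m + s *\<^sub>R e \<in> ?\<Lambda>" if "\<bar>s\<bar> = t" for s
    proof (rule multipliers_of_perturb[OF m])
      fix j assume "j \<in> C i"
      moreover have "\<bar>s * e $ j\<bar> = \<bar>t * e $ j\<bar>" using that \<open>0 < t\<close> by (simp add: abs_mult)
      ultimately have "\<bar>s * e $ j\<bar> \<le> m $ j" using bound by simp
      then show "0 \<le> m $ j + (s *\<^sub>R e) $ j" by simp
    qed (use e0 esum in \<open>auto simp flip: scaleR_scaleR scaleR_sum_right\<close>)
    have "m + t *\<^sub>R e \<in> ?\<Lambda>" "m + (- t) *\<^sub>R e \<in> ?\<Lambda>" 
      using in_both[of t] in_both[of "- t"] \<open>0 < t\<close> by simp_all
    moreover have "m = midpoint (m + t *\<^sub>R e) (m + (- t) *\<^sub>R e)"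
      by (simp add: midpoint_def flip: scaleR_2)
    moreover have "m + t *\<^sub>R e \<noteq> m + (- t) *\<^sub>R e"
      using enz \<open>0 < t\<close> by (simp add: scaleR_right_imp_eq flip: scaleR_minus_left)
    ultimately show False using ext by (metis extreme_point_of_def midpoint_in_open_segment)
  qed
next
  assume m: "m \<in> ?\<Lambda>" and ind: "independent_family ?a ?I"
  show "m extreme_point_of ?\<Lambda>"
    unfolding extreme_point_of_def
  proof (intro conjI ballI notI)
    fix p q assume p: "p \<in> ?\<Lambda>" and q: "q \<in> ?\<Lambda>" and "m \<in> open_segment p q"
    then obtain u where "p \<noteq> q" and u: "0 < u" "u < 1" and mu: "m = (1 - u) *\<^sub>R p + u *\<^sub>R q"
      by (auto simp: in_segment)
    have zero: "p $ j = 0 \<and> q $ j = 0" if "j \<in> C i" "m $ j = 0" for j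
    proof -
      have "0 \<le> (1 - u) * p $ j" "0 \<le> u * q $ j" using p q u that by (auto simp: multipliers_of_def)
      moreover have "(1 - u) * p $ j + u * q $ j = 0" using that mu by simp
      ultimately show ?thesis using u by (simp add: add_nonneg_eq_0_iff)
    qed
    have "(\<Sum>j\<in>?I. (p $ j - q $ j) *\<^sub>R ?a j) = (\<Sum>j\<in>C i. (p $ j - q $ j) *\<^sub>R ?a j)"
      using zero by (intro sum.mono_neutral_left) auto
    also have "\<dots> = (\<Sum>j\<in>C i. p $ j *\<^sub>R ?a j) - (\<Sum>j\<in>C i. q $ j *\<^sub>R ?a j)"
      by (simp add: scaleR_left_diff_distrib sum_subtractf)
    also have "\<dots> = 0"
    proof -
      have "grad_obj D \<theta> i x y + (\<Sum>j\<in>C i. p $ j *\<^sub>R ?a j) = grad_obj D \<theta> i x y + (\<Sum>j\<in>C i. q $ j *\<^sub>R ?a j)"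
        using p q by (simp add: multipliers_of_def)
      then show ?thesis by simp
    qed
    finally have "p $ j - q $ j = 0" if "j \<in> ?I" for j
      using independent_familyD[OF ind, of "\<lambda>j. p $ j - q $ j"] that by blast
    moreover have "p $ j = q $ j" if "j \<notin> ?I" for j
      using that zero[of j] p q by (cases "j \<in> C i") (auto simp: multipliers_of_def coord_space_def)
    ultimately have "p = q" by (fastforce simp: vec_eq_iff)
    with \<open>p \<noteq> q\<close> show False by contradiction
  qed (rule m)
qed

lemma extreme_point_of_multipliersI:
  assumes ext: "\<And>i. \<mu> $ i extreme_point_of multipliers_of D C \<theta> g i x y"
  shows "\<mu> extreme_point_of multipliers D C \<theta> g x y"
  unfolding extreme_point_of_def
proof (intro conjI ballI notI)
  show "\<mu> \<in> multipliers D C \<theta> g x y"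
    using ext by (simp add: multipliers_def extreme_point_of_def)
  fix p q assume p: "p \<in> multipliers D C \<theta> g x y" and q: "q \<in> multipliers D C \<theta> g x y"
    and seg: "\<mu> \<in> open_segment p q"
  then obtain u where "p \<noteq> q" and u: "0 < u" "u < 1" "\<mu> = (1 - u) *\<^sub>R p + u *\<^sub>R q"
    by (auto simp: in_segment)
  have "p $ i = q $ i" for i
  proof (rule ccontr)
    assume "p $ i \<noteq> q $ i"
    then have "\<mu> $ i \<in> open_segment (p $ i) (q $ i)" using u by (auto simp: in_segment)
    moreover have "p $ i \<in> multipliers_of D C \<theta> g i x y" "q $ i \<in> multipliers_of D C \<theta> g i x y"
      using p q by (auto simp: multipliers_def)
    ultimately show False using ext[of i] by (auto simp: extreme_point_of_def)
  qed
  then show False using \<open>p \<noteq> q\<close> by (simp add: vec_eq_iff)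
qed

section \<open>Smooth convex followers\<close>

lemma replace_block_self [simp]: "replace_block y i (y $ i) = y"
  by (simp add: replace_block_def vec_eq_iff)

lemma profiles_block: "y \<in> profiles D \<Longrightarrow> y $ i \<in> coord_space (D i)"
  by (simp add: profiles_def)

locale smooth_convex_followers =
  fixes D :: "'f::finite \<Rightarrow> 'm::finite set"
    and C :: "'f \<Rightarrow> 'q::finite set"
    and \<theta> :: "'f \<Rightarrow> 'x::topological_space \<Rightarrow> real ^ 'm ^ 'f \<Rightarrow> real"
    and g :: "'f \<Rightarrow> 'q \<Rightarrow> 'x \<Rightarrow> real ^ 'm \<Rightarrow> real"
  assumes obj_diff: "y \<in> profiles D \<Longrightarrow>
      (\<lambda>v. \<theta> i x (replace_block y i v)) differentiable_on coord_space (D i)"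
    and grad_obj_cont: "continuous_on (UNIV \<times> profiles D) (\<lambda>(x, y). grad_obj D \<theta> i x y)"
    and con_diff: "j \<in> C i \<Longrightarrow> g i j x differentiable_on coord_space (D i)"
    and grad_con_cont: "j \<in> C i \<Longrightarrow>
      continuous_on (UNIV \<times> coord_space (D i)) (\<lambda>(x, v). grad_con D g i j x v)"
    and con_cont: "j \<in> C i \<Longrightarrow>
      continuous_on (UNIV \<times> coord_space (D i)) (\<lambda>(x, v). g i j x v)"
    and obj_convex: "y \<in> profiles D \<Longrightarrow>
      convex_on (coord_space (D i)) (\<lambda>v. \<theta> i x (replace_block y i v))"
    and con_convex: "j \<in> C i \<Longrightarrow> convex_on (coord_space (D i)) (g i j x)"
begin

text \<open>
  The inner product of the stationarity equation with \<open>w - y $ i\<close>, with the constraints bounded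
  below by their tangents and complementarity removing the values at \<open>y $ i\<close>. For a feasible \<open>w\<close>
  the left side is nonnegative, which makes \<open>y $ i\<close> optimal; for a Slater point \<open>w\<close> the left side
  controls the size of \<open>m\<close>.
\<close>
lemma multiplier_gradient_bound:
  assumes y: "y \<in> profiles D" and m: "m \<in> multipliers_of D C \<theta> g i x y"
    and w: "w \<in> coord_space (D i)"
  shows "- (\<Sum>j\<in>C i. m $ j * g i j x w) \<le> (w - y $ i) \<bullet> grad_obj D \<theta> i x y"
proof -
  let ?a = "\<lambda>j. grad_con D g i j x (y $ i)"
  have "grad_obj D \<theta> i x y = - (\<Sum>j\<in>C i. m $ j *\<^sub>R ?a j)"
    using m by (simp add: multipliers_of_def eq_neg_iff_add_eq_0)
  then have "(w - y $ i) \<bullet> grad_obj D \<theta> i x y = - (\<Sum>j\<in>C i. m $ j * ((w - y $ i) \<bullet> ?a j))"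
    by (simp add: inner_sum_right)
  moreover have "m $ j * ((w - y $ i) \<bullet> ?a j) \<le> m $ j * g i j x w" if j: "j \<in> C i" for j
  proof -
    have "m $ j * ((w - y $ i) \<bullet> ?a j) \<le> m $ j * (g i j x w - g i j x (y $ i))"
      using convex_on_above_tangent_grad_on[OF subspace_coord_space profiles_block[OF y] w
          con_diff[OF j] con_convex[OF j], of x] m j
      by (intro mult_left_mono) (auto simp: grad_con_def multipliers_of_def)
    then show ?thesis using multipliers_of_complementarity[OF m j] by (simp add: right_diff_distrib)
  qed
  ultimately show ?thesis by (simp add: sum_mono)
qed

lemma multipliers_imp_NEP:
  assumes y: "y \<in> profiles D" and \<mu>: "\<mu> \<in> multipliers D C \<theta> g x y"
  shows "y \<in> NEP D C \<theta> g x"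
  unfolding NEP_def
proof (intro CollectI conjI allI ballI)
  fix i
  have m: "\<mu> $ i \<in> multipliers_of D C \<theta> g i x y" using \<mu> by (simp add: multipliers_def)
  then show "y $ i \<in> feasible_set D C g i x"
    using profiles_block[OF y] by (simp add: multipliers_of_def feasible_set_def)
  fix v assume v: "v \<in> feasible_set D C g i x"
  then have vS: "v \<in> coord_space (D i)" by (simp add: feasible_set_def)
  have "0 \<le> - (\<Sum>j\<in>C i. \<mu> $ i $ j * g i j x v)"
    using m v by (auto simp: multipliers_of_def feasible_set_def intro!: sum_nonpos mult_nonneg_nonpos)
  also have "\<dots> \<le> (v - y $ i) \<bullet> grad_obj D \<theta> i x y"
    by (rule multiplier_gradient_bound[OF y m vS])
  also have "\<dots> \<le> \<theta> i x (replace_block y i v) - \<theta> i x y"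
    using convex_on_above_tangent_grad_on[OF subspace_coord_space profiles_block[OF y] vS
        obj_diff[OF y] obj_convex[OF y], of x]
    by (simp add: grad_obj_def)
  finally show "\<theta> i x y \<le> \<theta> i x (replace_block y i v)" by simp
qed (rule y)

lemma NEP_imp_multipliers_of_nonempty:
  assumes y: "y \<in> NEP D C \<theta> g x" and slater: "slater D C g i x"
  shows "multipliers_of D C \<theta> g i x y \<noteq> {}"
proof -
  let ?S = "coord_space (D i)"
  have yP: "y \<in> profiles D" and feas: "y $ i \<in> feasible_set D C g i x"
    and min: "\<And>v. v \<in> feasible_set D C g i x \<Longrightarrow> \<theta> i x y \<le> \<theta> i x (replace_block y i v)"
    using y by (auto simp: NEP_def)
  obtain w where w: "w \<in> ?S" "\<And>j. j \<in> C i \<Longrightarrow> g i j x w < 0"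
    using slater by (auto simp: slater_def)
  obtain u where u: "\<And>j. j \<in> C i \<Longrightarrow> 0 \<le> u j" "\<And>j. j \<in> C i \<Longrightarrow> u j * g i j x (y $ i) = 0"
    "grad_obj D \<theta> i x y + (\<Sum>j\<in>C i. u j *\<^sub>R grad_con D g i j x (y $ i)) = 0"
    unfolding grad_obj_def grad_con_def
  proof (rule convex_minimizer_has_kkt_multipliers[where J = "C i" and c = "\<lambda>j. g i j x" and S = ?S
        and z = "y $ i" and f = "\<lambda>v. \<theta> i x (replace_block y i v)" and w = w])
    show "g i j x (y $ i) \<le> 0" if "j \<in> C i" for j using feas that by (simp add: feasible_set_def)
    show "\<theta> i x (replace_block y i (y $ i)) \<le> \<theta> i x (replace_block y i v)"
      if "v \<in> ?S" "\<And>j. j \<in> C i \<Longrightarrow> g i j x v \<le> 0" for v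
      using min[of v] that by (simp add: feasible_set_def)
  qed (use subspace_coord_space profiles_block[OF yP] obj_diff[OF yP] con_diff con_convex w
      in auto)
  then have "(\<chi> j. if j \<in> C i then u j else 0) \<in> multipliers_of D C \<theta> g i x y"
    using feas by (auto simp: multipliers_of_def coord_space_def feasible_set_def
        cong: sum.cong intro!: sum.neutral)
  then show ?thesis by blast
qed

text \<open>
  The continuity hypotheses in the form in which sequences use them. They hold only on the
  coordinate subspaces, hence the membership premises.
\<close>
lemma tendsto_data:
  assumes X: "(X \<longlongrightarrow> x) F" and Y: "(Y \<longlongrightarrow> y) F"
    and P: "\<And>k. Y k \<in> profiles D" "y \<in> profiles D"
  shows tendsto_grad_obj: "((\<lambda>k. grad_obj D \<theta> i (X k) (Y k)) \<longlongrightarrow> grad_obj D \<theta> i x y) F"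
    and tendsto_grad_con: "j \<in> C i \<Longrightarrow>
      ((\<lambda>k. grad_con D g i j (X k) (Y k $ i)) \<longlongrightarrow> grad_con D g i j x (y $ i)) F"
    and tendsto_con: "j \<in> C i \<Longrightarrow> ((\<lambda>k. g i j (X k) (Y k $ i)) \<longlongrightarrow> g i j x (y $ i)) F"
proof -
  have XY: "((\<lambda>k. (X k, Y k)) \<longlongrightarrow> (x, y)) F" using X Y by (rule tendsto_Pair)
  have XYi: "((\<lambda>k. (X k, Y k $ i)) \<longlongrightarrow> (x, y $ i)) F"
    using X Y by (intro tendsto_Pair tendsto_vec_nth)
  show "((\<lambda>k. grad_obj D \<theta> i (X k) (Y k)) \<longlongrightarrow> grad_obj D \<theta> i x y) F"
    using continuous_on_tendsto_compose[OF grad_obj_cont XY] P by simp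
  show "((\<lambda>k. grad_con D g i j (X k) (Y k $ i)) \<longlongrightarrow> grad_con D g i j x (y $ i)) F" if "j \<in> C i"
    using continuous_on_tendsto_compose[OF grad_con_cont[OF that] XYi] P by (simp add: profiles_block)
  show "((\<lambda>k. g i j (X k) (Y k $ i)) \<longlongrightarrow> g i j x (y $ i)) F" if "j \<in> C i"
    using continuous_on_tendsto_compose[OF con_cont[OF that] XYi] P by (simp add: profiles_block)
qed

lemma limit_of_multipliers:
  assumes X: "X \<longlonglongrightarrow> x" and Y: "Y \<longlonglongrightarrow> y" and M: "M \<longlonglongrightarrow> m"
    and P: "\<And>k. Y k \<in> profiles D" "y \<in> profiles D"
    and mult: "\<And>k. M k \<in> multipliers_of D C \<theta> g i (X k) (Y k)"
  shows "m \<in> multipliers_of D C \<theta> g i x y"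
proof -
  note [tendsto_intros] = tendsto_grad_obj[OF X Y P] tendsto_grad_con[OF X Y P] tendsto_con[OF X Y P]
    tendsto_vec_nth[OF M]
  let ?G = "\<lambda>k. grad_obj D \<theta> i (X k) (Y k) + (\<Sum>j\<in>C i. M k $ j *\<^sub>R grad_con D g i j (X k) (Y k $ i))"
  let ?c = "\<lambda>k. \<Sum>j\<in>C i. M k $ j * g i j (X k) (Y k $ i)"
  have "?G \<longlonglongrightarrow> grad_obj D \<theta> i x y + (\<Sum>j\<in>C i. m $ j *\<^sub>R grad_con D g i j x (y $ i))"
    by (intro tendsto_intros)
  moreover have "?G = (\<lambda>k. 0)" using mult by (simp add: multipliers_of_def)
  ultimately have stat: "grad_obj D \<theta> i x y + (\<Sum>j\<in>C i. m $ j *\<^sub>R grad_con D g i j x (y $ i)) = 0"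
    by (simp add: LIMSEQ_const_iff)
  have "?c \<longlonglongrightarrow> (\<Sum>j\<in>C i. m $ j * g i j x (y $ i))" by (intro tendsto_intros)
  moreover have "?c = (\<lambda>k. 0)" using mult by (simp add: multipliers_of_def)
  ultimately have compl: "(\<Sum>j\<in>C i. m $ j * g i j x (y $ i)) = 0" by (simp add: LIMSEQ_const_iff)
  have feas: "g i j x (y $ i) \<le> 0" if "j \<in> C i" for j
    using mult that by (intro LIMSEQ_le_const2[OF tendsto_con[OF X Y P that]]) (auto simp: multipliers_of_def)
  have nonneg: "0 \<le> m $ j" if "j \<in> C i" for j
    using mult that by (intro LIMSEQ_le_const[OF tendsto_vec_nth[OF M]]) (auto simp: multipliers_of_def)
  have "\<forall>k. M k \<in> coord_space (C i)" using mult by (simp add: multipliers_of_def)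
  then have "m \<in> coord_space (C i)"
    using closed_sequentially[OF closed_subspace[OF subspace_coord_space] _ M] by blast
  then show ?thesis using stat compl feas nonneg by (simp add: multipliers_of_def)
qed

text \<open>
  A point at which all constraints have slack greater than \<open>c\<close> keeps it at nearby parameters.
  There \<open>multiplier_gradient_bound\<close> bounds \<open>c\<close> times the sum of the multipliers by a quantity
  that converges along the sequence and is therefore bounded.
\<close>
lemma slater_locally_bounds_multipliers:
  assumes X: "X \<longlonglongrightarrow> x" and Y: "Y \<longlonglongrightarrow> y" and P: "\<And>k. Y k \<in> profiles D" "y \<in> profiles D"
    and slater: "slater D C g i x"
  obtains B where "\<forall>\<^sub>F k in sequentially. slater D C g i (X k) \<and>
    (\<forall>m \<in> multipliers_of D C \<theta> g i (X k) (Y k). norm m \<le> B)"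
proof -
  obtain w where w: "w \<in> coord_space (D i)" "\<And>j. j \<in> C i \<Longrightarrow> g i j x w < 0"
    using slater by (auto simp: slater_def)
  have "\<exists>c>0. \<forall>j\<in>C i. g i j x w < - c"
  proof (cases "C i = {}")
    case False
    \<comment> \<open>Half of the smallest slack, so that the inequality with \<open>c\<close> is strict.\<close>
    let ?b = "Max ((\<lambda>j. g i j x w) ` C i)"
    have neg: "?b < 0" using False w by (subst Max_less_iff) auto
    have "g i j x w < - (- ?b / 2)" if "j \<in> C i" for j
    proof -
      have "g i j x w \<le> ?b" using that by (intro Max_ge) auto
      then show ?thesis using neg by linarith
    qed
    moreover have "0 < - ?b / 2" using neg by simp
    ultimately show ?thesis by (intro exI[of _ "- ?b / 2"] conjI ballI)
  qed (auto intro: exI[of _ 1])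
  then obtain c where c: "c > 0" "\<And>j. j \<in> C i \<Longrightarrow> g i j x w < - c" by blast
  have lim: "(\<lambda>k. g i j (X k) w) \<longlonglongrightarrow> g i j x w" if "j \<in> C i" for j
    using continuous_on_tendsto_compose[OF con_cont[OF that] tendsto_Pair[OF X tendsto_const[of w]]] w(1)
    by simp
  have "\<forall>\<^sub>F k in sequentially. g i j (X k) w < - c" if "j \<in> C i" for j
    by (rule order_tendstoD(2)[OF lim[OF that] c(2)[OF that]])
  then have ev: "\<forall>\<^sub>F k in sequentially. \<forall>j\<in>C i. g i j (X k) w < - c"
    by (simp add: eventually_ball_finite)
  let ?h = "\<lambda>k. (w - Y k $ i) \<bullet> grad_obj D \<theta> i (X k) (Y k)"
  have "?h \<longlonglongrightarrow> (w - y $ i) \<bullet> grad_obj D \<theta> i x y"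
    by (intro tendsto_intros tendsto_vec_nth[OF Y] tendsto_grad_obj[OF X Y P])
  then obtain K where K: "\<And>k. norm (?h k) \<le> K"
    using convergent_imp_Bseq[OF convergentI, of ?h] unfolding Bseq_def by blast
  have "\<forall>\<^sub>F k in sequentially. slater D C g i (X k) \<and>
    (\<forall>m \<in> multipliers_of D C \<theta> g i (X k) (Y k). norm m \<le> K / c)"
    using ev
  proof eventually_elim
    case (elim k)
    have "norm m \<le> K / c" if m: "m \<in> multipliers_of D C \<theta> g i (X k) (Y k)" for m
    proof -
      have nonneg: "\<And>j. j \<in> C i \<Longrightarrow> 0 \<le> m $ j" and zero: "\<And>j. j \<notin> C i \<Longrightarrow> m $ j = 0"
        using m by (auto simp: multipliers_of_def coord_space_def)
      have "c * (\<Sum>j\<in>C i. m $ j) \<le> - (\<Sum>j\<in>C i. m $ j * g i j (X k) w)"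
        unfolding sum_distrib_left sum_negf[symmetric]
      proof (rule sum_mono)
        fix j assume j: "j \<in> C i"
        then have "m $ j * c \<le> m $ j * (- g i j (X k) w)"
          using nonneg elim by (intro mult_left_mono) (auto simp: less_imp_le)
        then show "c * m $ j \<le> - (m $ j * g i j (X k) w)" by (simp add: mult.commute)
      qed
      also have "\<dots> \<le> ?h k" by (rule multiplier_gradient_bound[OF P(1) m w(1)])
      also have "\<dots> \<le> K" using K[of k] by simp
      finally have sum: "(\<Sum>j\<in>C i. m $ j) \<le> K / c" using c(1) by (simp add: field_simps)
      have "norm m \<le> (\<Sum>j\<in>UNIV. \<bar>m $ j\<bar>)" by (rule norm_le_l1_cart)
      also have "\<dots> = (\<Sum>j\<in>C i. m $ j)"
        using nonneg zero by (intro sum.mono_neutral_cong_right) auto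
      finally show ?thesis using sum by simp
    qed
    moreover have "slater D C g i (X k)"
      unfolding slater_def using elim c(1) by (intro bexI[OF _ w(1)]) force
    ultimately show ?case by blast
  qed
  then show ?thesis by (rule that)
qed

text \<open>
  A nonempty compact convex set has an extreme point. Slater's bound for constant sequences gives
  boundedness, and limits of multipliers at a fixed point give closedness.
\<close>
lemma extreme_multiplier_exists:
  assumes y: "y \<in> profiles D" and slater: "slater D C g i x"
    and nonempty: "multipliers_of D C \<theta> g i x y \<noteq> {}"
  obtains m where "m extreme_point_of multipliers_of D C \<theta> g i x y"
proof -
  have "bounded (multipliers_of D C \<theta> g i x y)"
    using slater_locally_bounds_multipliers[OF tendsto_const tendsto_const y y slater]
    by (auto simp: bounded_iff)
  moreover have "closed (multipliers_of D C \<theta> g i x y)"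
    unfolding closed_sequential_limits
    using limit_of_multipliers[OF tendsto_const tendsto_const _ y y] by blast
  ultimately have "compact (multipliers_of D C \<theta> g i x y)" by (simp add: compact_eq_bounded_closed)
  from extreme_point_exists_convex[OF this convex_multipliers_of nonempty] show ?thesis using that by blast
qed

text \<open>
  The support of a limit can only be smaller than the supports along the sequence, so its gradients
  are independent at points near \<open>(x, y $ i)\<close>. Independence alone could be lost in the limit; the
  constant rank condition, which applies because complementarity makes the constraints in the
  support active at the limit, excludes this.
\<close>
lemma limit_of_extreme_multipliers:
  assumes X: "X \<longlonglongrightarrow> x" and Y: "Y \<longlonglongrightarrow> y" and M: "M \<longlonglongrightarrow> m"
    and P: "\<And>k. Y k \<in> profiles D" "y \<in> profiles D"
    and ext: "\<And>k. M k extreme_point_of multipliers_of D C \<theta> g i (X k) (Y k)"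
    and crcq: "CRCQ D C g i x (y $ i)"
  shows "m extreme_point_of multipliers_of D C \<theta> g i x y"
proof -
  have m: "m \<in> multipliers_of D C \<theta> g i x y"
    by (rule limit_of_multipliers[OF X Y M P]) (use ext in \<open>simp add: extreme_point_of_def\<close>)
  let ?I = "{j \<in> C i. m $ j \<noteq> 0}"
  have active: "?I \<subseteq> {j \<in> C i. g i j x (y $ i) = 0}"
    using multipliers_of_complementarity[OF m] by auto
  obtain V where V: "open V" "(x, y $ i) \<in> V"
    and rank: "\<forall>I \<subseteq> {j \<in> C i. g i j x (y $ i) = 0}. \<exists>r. \<forall>x v. (x, v) \<in> V \<and> v \<in> coord_space (D i) \<longrightarrow>
        rank ((\<chi> j. if j \<in> I then grad_con D g i j x v else 0) :: real ^ 'm ^ 'q) = r"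
    using crcq unfolding CRCQ_def by blast
  obtain r where r: "\<And>x v. (x, v) \<in> V \<Longrightarrow> v \<in> coord_space (D i) \<Longrightarrow>
        rank ((\<chi> j. if j \<in> ?I then grad_con D g i j x v else 0) :: real ^ 'm ^ 'q) = r"
    using rank[rule_format, OF active] by blast
  have "(\<lambda>k. (X k, Y k $ i)) \<longlonglongrightarrow> (x, y $ i)"
    using X Y by (intro tendsto_Pair tendsto_vec_nth)
  then have "\<forall>\<^sub>F k in sequentially. (X k, Y k $ i) \<in> V" using V by (rule topological_tendstoD)
  moreover have "\<forall>\<^sub>F k in sequentially. \<forall>j\<in>?I. M k $ j \<noteq> 0"
    using tendsto_imp_eventually_ne[OF tendsto_vec_nth[OF M]] by (intro eventually_ball_finite) auto
  ultimately have "\<forall>\<^sub>F k in sequentially. (X k, Y k $ i) \<in> V \<and> (\<forall>j\<in>?I. M k $ j \<noteq> 0)"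
    by (rule eventually_conj)
  then obtain k where k: "(X k, Y k $ i) \<in> V" "\<forall>j\<in>?I. M k $ j \<noteq> 0"
    by (auto simp: eventually_sequentially)
  have "independent_family (\<lambda>j. grad_con D g i j (X k) (Y k $ i)) ?I"
    by (rule independent_family_subset[of _ "{j \<in> C i. M k $ j \<noteq> 0}"])
      (use ext[of k] k(2) in \<open>auto simp: extreme_multiplier_iff\<close>)
  then have "r = card ?I"
    using r[OF k(1) profiles_block[OF P(1)]] by (simp add: independent_family_iff_rank)
  then have "independent_family (\<lambda>j. grad_con D g i j x (y $ i)) ?I"
    using r[OF V(2) profiles_block[OF P(2)]] by (simp add: independent_family_iff_rank)
  with m show ?thesis by (simp add: extreme_multiplier_iff)
qed

text \<open>
  The existence and stability results of the individual followers combined: the blocks are chosen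
  separately as vertices, and compactness is used once for the joint multiplier.
\<close>
lemma equilibria_have_subconverging_vertices:
  assumes X: "X \<longlonglongrightarrow> x" and Y: "Y \<longlonglongrightarrow> y" and y: "y \<in> profiles D"
    and nash: "\<And>k. Y k \<in> NEP D C \<theta> g (X k)"
    and slater: "\<And>i. slater D C g i x" and crcq: "\<And>i. CRCQ D C g i x (y $ i)"
  obtains r M \<mu> where "filterlim r sequentially sequentially"
    "\<And>k. M k \<in> multipliers D C \<theta> g (X (r k)) (Y (r k))"
    "M \<longlonglongrightarrow> \<mu>" "\<mu> extreme_point_of multipliers D C \<theta> g x y"
proof -
  have P: "Y k \<in> profiles D" for k using nash[of k] by (simp add: NEP_def)
  define good where "good k i b \<longleftrightarrow> slater D C g i (X k) \<and>
    (\<forall>m \<in> multipliers_of D C \<theta> g i (X k) (Y k). norm m \<le> b)" for k i b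
  have "\<exists>b. eventually (\<lambda>k. good k i b) sequentially" for i
    unfolding good_def by (rule slater_locally_bounds_multipliers[OF X Y P y slater]) (rule exI)
  then obtain B where "\<And>i. eventually (\<lambda>k. good k i (B i)) sequentially" by metis
  then have "\<forall>\<^sub>F k in sequentially. \<forall>i. good k i (B i)" by (rule eventually_all_finite)
  \<comment> \<open>The sequence is shifted by \<open>N\<close>, so that the bounds hold for all of its members.\<close>
  then obtain N where "\<And>k. N \<le> k \<Longrightarrow> \<forall>i. good k i (B i)"
    unfolding eventually_sequentially by blast
  then have good: "good (k + N) i (B i)" for k i by simp
  define m where "m k i = (SOME m. m extreme_point_of multipliers_of D C \<theta> g i (X (k + N)) (Y (k + N)))" for k i
  have m: "m k i extreme_point_of multipliers_of D C \<theta> g i (X (k + N)) (Y (k + N))" for k i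
  proof -
    have sl: "slater D C g i (X (k + N))" using good[of k i] by (simp add: good_def)
    have "\<exists>m. m extreme_point_of multipliers_of D C \<theta> g i (X (k + N)) (Y (k + N))"
      by (rule extreme_multiplier_exists[OF P sl NEP_imp_multipliers_of_nonempty[OF nash sl]]) (rule exI)
    then show ?thesis unfolding m_def by (rule someI_ex)
  qed
  define M where "M k = (\<chi> i. m k i)" for k
  have M: "M k $ i extreme_point_of multipliers_of D C \<theta> g i (X (k + N)) (Y (k + N))" for k i
    by (simp add: M_def m)
  have "norm (M k) \<le> sum B UNIV" for k
  proof -
    have "norm (M k) \<le> (\<Sum>i\<in>UNIV. norm (M k $ i))" by (simp add: norm_vec_def L2_set_le_sum)
    also have "\<dots> \<le> sum B UNIV"
    proof (rule sum_mono)
      fix i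
      have "M k $ i \<in> multipliers_of D C \<theta> g i (X (k + N)) (Y (k + N))"
        using M[of k i] by (simp add: extreme_point_of_def)
      then show "norm (M k $ i) \<le> B i" using good[of k i] unfolding good_def by blast
    qed
    finally show ?thesis .
  qed
  then have "bounded (range M)" by (auto simp: bounded_iff)
  then obtain \<mu> s where s: "strict_mono (s :: nat \<Rightarrow> nat)" and lim: "(M \<circ> s) \<longlonglongrightarrow> \<mu>"
    using bounded_imp_convergent_subsequence by blast
  let ?r = "\<lambda>k. s k + N"
  have r: "filterlim ?r sequentially sequentially"
    by (rule filterlim_compose[OF filterlim_add_const_nat_at_top filterlim_subseq[OF s]])
  show ?thesis
  proof (rule that[of ?r "M \<circ> s" \<mu>])
    show "(M \<circ> s) k \<in> multipliers D C \<theta> g (X (?r k)) (Y (?r k))" for k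
      using M by (simp add: multipliers_def extreme_point_of_def)
    have "\<mu> $ i extreme_point_of multipliers_of D C \<theta> g i x y" for i
      by (rule limit_of_extreme_multipliers[OF filterlim_compose[OF X r] filterlim_compose[OF Y r]
            tendsto_vec_nth[OF lim] P y _ crcq]) (simp add: M)
    then show "\<mu> extreme_point_of multipliers D C \<theta> g x y" by (rule extreme_point_of_multipliersI)
  qed (use r lim in auto)
qed

end

section \<open>Local solutions of the MPCC and of the game\<close>

lemma not_local_minimum_sequence:
  fixes z :: "'a::metric_space"
  assumes z: "z \<in> S" and not_min: "\<not> local_minimum f S z"
  obtains w where "\<And>k. w k \<in> S" "\<And>k. f (w k) < f z" "w \<longlonglongrightarrow> z"
proof -
  have "\<exists>w\<in>S \<inter> ball z (inverse (real (Suc k))). f w < f z" for k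
  proof (rule ccontr)
    assume "\<not> (\<exists>w\<in>S \<inter> ball z (inverse (real (Suc k))). f w < f z)"
    then have "\<forall>w\<in>S \<inter> ball z (inverse (real (Suc k))). f z \<le> f w" by (meson not_less)
    then have "local_minimum f S z"
      unfolding local_minimum_def using z
      by (intro conjI exI[of _ "ball z (inverse (real (Suc k)))"]) simp_all
    with not_min show False by contradiction
  qed
  then obtain w where w: "\<And>k. w k \<in> S \<inter> ball z (inverse (real (Suc k)))" "\<And>k. f (w k) < f z"
    by metis
  have "dist (w k) z \<le> inverse (real (Suc k))" for k
    using w(1)[of k] by (simp add: dist_commute less_imp_le)
  then have "(\<lambda>k. dist (w k) z) \<longlonglongrightarrow> 0"
    by (intro tendsto_sandwich[OF _ _ tendsto_const LIMSEQ_inverse_real_of_nat]) auto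
  then have "w \<longlonglongrightarrow> z" by (simp add: tendsto_dist_iff[of w])
  with w show ?thesis using that by blast
qed

theorem theorem5:
  fixes D :: "'f::finite \<Rightarrow> 'm::finite set"
    and C :: "'f \<Rightarrow> 'q::finite set"
    and X :: "(real ^ 'n0::finite) set"
    and \<theta>\<^sub>0 :: "real ^ 'n0 \<Rightarrow> real ^ 'm ^ 'f \<Rightarrow> real"
    and \<theta> :: "'f \<Rightarrow> real ^ 'n0 \<Rightarrow> real ^ 'm ^ 'f \<Rightarrow> real"
    and g :: "'f \<Rightarrow> 'q \<Rightarrow> real ^ 'n0 \<Rightarrow> real ^ 'm \<Rightarrow> real"
    and x\<^sub>0 :: "real ^ 'n0" and y\<^sub>0 :: "real ^ 'm ^ 'f"
  assumes obj_diff: "\<And>i x y. y \<in> profiles D \<Longrightarrow>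
      (\<lambda>v. \<theta> i x (replace_block y i v)) differentiable_on coord_space (D i)"
    and grad_obj_cont: "\<And>i. continuous_on (UNIV \<times> profiles D) (\<lambda>(x, y). grad_obj D \<theta> i x y)"
    and con_diff: "\<And>i j x. j \<in> C i \<Longrightarrow> g i j x differentiable_on coord_space (D i)"
    and grad_con_cont: "\<And>i j. j \<in> C i \<Longrightarrow>
      continuous_on (UNIV \<times> coord_space (D i)) (\<lambda>(x, v). grad_con D g i j x v)"
    and con_cont: "\<And>i j. j \<in> C i \<Longrightarrow>
      continuous_on (UNIV \<times> coord_space (D i)) (\<lambda>(x, v). g i j x v)"
    and obj_convex: "\<And>i x y. y \<in> profiles D \<Longrightarrow>
      convex_on (coord_space (D i)) (\<lambda>v. \<theta> i x (replace_block y i v))"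
    and con_convex: "\<And>i j x. j \<in> C i \<Longrightarrow> convex_on (coord_space (D i)) (g i j x)"
    and slater: "\<And>i. slater D C g i x\<^sub>0"
    and y\<^sub>0: "y\<^sub>0 \<in> profiles D"
    and nonempty: "multipliers D C \<theta> g x\<^sub>0 y\<^sub>0 \<noteq> {}"
    and local_min: "\<And>\<mu>. \<mu> extreme_point_of multipliers D C \<theta> g x\<^sub>0 y\<^sub>0 \<Longrightarrow>
      MPCC_local_minimum D C X \<theta>\<^sub>0 \<theta> g (x\<^sub>0, y\<^sub>0, \<mu>)"
    and crcq: "\<And>i. CRCQ D C g i x\<^sub>0 (y\<^sub>0 $ i)"
  shows "SLMFG_local_minimum D C X \<theta>\<^sub>0 \<theta> g (x\<^sub>0, y\<^sub>0)"
proof -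
  interpret smooth_convex_followers D C \<theta> g
    by unfold_locales (fact obj_diff grad_obj_cont con_diff grad_con_cont con_cont obj_convex con_convex)+
  let ?F = "{(x, y). x \<in> X \<and> y \<in> NEP D C \<theta> g x}"
  obtain \<mu>\<^sub>0 where \<mu>\<^sub>0: "\<mu>\<^sub>0 \<in> multipliers D C \<theta> g x\<^sub>0 y\<^sub>0" using nonempty by blast
  have nash: "y\<^sub>0 \<in> NEP D C \<theta> g x\<^sub>0" by (rule multipliers_imp_NEP[OF y\<^sub>0 \<mu>\<^sub>0])
  \<comment> \<open>A constant sequence of equilibria yields one vertex, and the MPCC solution at it gives \<open>x\<^sub>0 \<in> X\<close>.\<close>
  obtain \<nu> where "\<nu> extreme_point_of multipliers D C \<theta> g x\<^sub>0 y\<^sub>0"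
    by (rule equilibria_have_subconverging_vertices[OF tendsto_const tendsto_const y\<^sub>0 nash slater crcq])
      (rule that)
  from local_min[OF this] have "x\<^sub>0 \<in> X" by (simp add: MPCC_local_minimum_def local_minimum_def)
  then have feas: "(x\<^sub>0, y\<^sub>0) \<in> ?F" using nash by simp
  show ?thesis
  proof (rule ccontr)
    assume "\<not> ?thesis"
    then have "\<not> local_minimum (\<lambda>(x, y). \<theta>\<^sub>0 x y) ?F (x\<^sub>0, y\<^sub>0)"
      by (simp only: SLMFG_local_minimum_def not_False_eq_True)
    from not_local_minimum_sequence[OF feas this] obtain w where w: "\<And>k. w k \<in> ?F"
      "\<And>k. (case w k of (x, y) \<Rightarrow> \<theta>\<^sub>0 x y) < (case (x\<^sub>0, y\<^sub>0) of (x, y) \<Rightarrow> \<theta>\<^sub>0 x y)"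
      and wlim: "w \<longlonglongrightarrow> (x\<^sub>0, y\<^sub>0)"
      by blast
    define u v where "u k = fst (w k)" and "v k = snd (w k)" for k
    have u: "u \<longlonglongrightarrow> x\<^sub>0" and v: "v \<longlonglongrightarrow> y\<^sub>0"
      using tendsto_fst[OF wlim] tendsto_snd[OF wlim] by (simp_all add: u_def[abs_def] v_def[abs_def])
    have uv: "u k \<in> X" "v k \<in> NEP D C \<theta> g (u k)" "\<theta>\<^sub>0 (u k) (v k) < \<theta>\<^sub>0 x\<^sub>0 y\<^sub>0" for k
      using w(1)[of k] w(2)[of k] by (auto simp: u_def v_def split_beta)
    obtain r M \<mu> where r: "filterlim r sequentially sequentially"
      and M: "\<And>k. M k \<in> multipliers D C \<theta> g (u (r k)) (v (r k))" "M \<longlonglongrightarrow> \<mu>"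
      and \<mu>: "\<mu> extreme_point_of multipliers D C \<theta> g x\<^sub>0 y\<^sub>0"
      by (rule equilibria_have_subconverging_vertices[OF u v y\<^sub>0 uv(2) slater crcq]) (rule that)
    from local_min[OF \<mu>] obtain U where U: "open U" "(x\<^sub>0, y\<^sub>0, \<mu>) \<in> U"
      and min: "\<forall>w \<in> {(x, y, \<mu>). x \<in> X \<and> y \<in> profiles D \<and> \<mu> \<in> multipliers D C \<theta> g x y} \<inter> U.
        \<theta>\<^sub>0 x\<^sub>0 y\<^sub>0 \<le> (case w of (x, y, \<mu>) \<Rightarrow> \<theta>\<^sub>0 x y)"
      unfolding MPCC_local_minimum_def local_minimum_def prod.case by (elim conjE exE)
    have "(\<lambda>k. (u (r k), v (r k), M k)) \<longlonglongrightarrow> (x\<^sub>0, y\<^sub>0, \<mu>)"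
      by (intro tendsto_Pair M(2) filterlim_compose[OF u r] filterlim_compose[OF v r])
    then have "\<forall>\<^sub>F k in sequentially. (u (r k), v (r k), M k) \<in> U" using U by (rule topological_tendstoD)
    then obtain k where "(u (r k), v (r k), M k) \<in> U" unfolding eventually_sequentially by blast
    moreover have "v (r k) \<in> profiles D" using uv(2)[of "r k"] by (simp add: NEP_def)
    ultimately have "\<theta>\<^sub>0 x\<^sub>0 y\<^sub>0 \<le> \<theta>\<^sub>0 (u (r k)) (v (r k))"
      using bspec[OF min, of "(u (r k), v (r k), M k)"] uv(1)[of "r k"] M(1)[of k] by simp
    with uv(3)[of "r k"] show False by simp
  qed
qed

end
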